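(* Let $\sigma \leq 1/2$ be a real number and let $r \ge 1$ be an integer. If $G$ is a finite simple graph on $n$ vertices that contains no clique on $r+1$ vertices and has more than \[ \left(1 - \frac{1}{r}\right)\frac{n^2}{2} - \frac{\sigma n}{2} \] edges, then $G$ contains an independent set $I$ such that more than $(1 - \sigma)(|I| - \sigma)$ vertices of $I$ are complete to $G - I$.
   Context: A vertex $v$ is complete to $G - I$ if $v$ is adjacent to every vertex of $V(G)\setminus I$. A graph is $K_{r+1}$-free if it has no clique on $r+1$ vertices. *)

theory Defs
  imports Complex_Main "HOL-Library.Ramsey"
begin

text \<open>A graph is a vertex set \<open>V\<close> with a set \<open>E\<close> of edges, each of which is a 2-element
  subset of \<open>V\<close> (\<^const>\<open>nsets\<close>). This is the representation on which
  \<^const>\<open>clique\<close> and \<^const>\<open>indep\<close> are defined in \<^theory>\<open>HOL-Library.Ramsey\<close>.\<close>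

definition finite_simple_graph :: "'a set \<Rightarrow> 'a set set \<Rightarrow> bool" where
  "finite_simple_graph V E \<longleftrightarrow> finite V \<and> E \<subseteq> nsets V 2"

definition clique_free :: "nat \<Rightarrow> 'a set \<Rightarrow> 'a set set \<Rightarrow> bool" where
  "clique_free k V E \<longleftrightarrow> \<not> (\<exists>K\<subseteq>V. card K = k \<and> clique K E)"

definition complete_to_rest :: "'a set \<Rightarrow> 'a set set \<Rightarrow> 'a set \<Rightarrow> 'a \<Rightarrow> bool" where
  "complete_to_rest V E I v \<longleftrightarrow> (\<forall>w\<in>V - I. {v, w} \<in> E)"

end

theory Submission
  imports Defs
begin

text \<open>For \<open>v\<close> in a vertex set \<open>U\<close> let \<open>c v\<close> be the number of non-neighbours of \<open>v\<close> in \<open>U\<close>,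
  \<open>v\<close> itself included. A vertex of an independent set \<open>I\<close> is complete to the rest iff its set of
  non-neighbours is exactly \<open>I\<close>. We strengthen Turan's inequality
  \<open>|U|\<^sup>2 \<le> \<omega> \<cdot> (\<Sum>v\<in>U. c v)\<close> to \<open>|U|\<^sup>2 \<le> \<omega> \<cdot> P\<close>, where \<open>P\<close> is the sum of \<open>c v - \<sigma>\<close> over \<open>U\<close> plus
  a surcharge \<open>max 0 (t - (1 - \<sigma>) |I|)\<close> for each independent \<open>I\<close> having \<open>t\<close> complete vertices.
  If the theorem fails, every surcharge vanishes and the inequality contradicts the edge count.

  The inequality is proved by deleting a set \<open>D\<close> whose removal lowers the clique number by \<open>j\<close> and
  \<open>P\<close> by at least \<open>|D|\<^sup>2 / j\<close>. If the non-neighbours of some \<open>v\<close> form an independent set, they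
  are such a \<open>D\<close>, with \<open>j = 1\<close>, thanks to the surcharge. Otherwise no surcharge is present; take \<open>v\<close>
  with \<open>c v\<close> minimal and let \<open>D\<close> be its set of non-neighbours. Either there are so many non-adjacent
  pairs between \<open>D\<close> and \<open>U - D\<close> that \<open>D\<close> works with \<open>j = 1\<close>, or fewer than \<open>c v\<close> of them; then
  two adjacent vertices of \<open>D\<close> have together at most \<open>2 c v - 1 \<le> 2 (c v - \<sigma>)\<close> non-neighbours,
  and these work with \<open>j = 2\<close>.\<close>

section \<open>Non-neighbourhoods and the potential\<close>

text \<open>\<open>v\<close> may lie outside \<open>U\<close>: after a deletion, the non-neighbours
  of a vertex are counted separately in the deleted and in the remaining part.\<close>

definition nonnbrs :: "'a set set \<Rightarrow> 'a set \<Rightarrow> 'a \<Rightarrow> 'a set" where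
  "nonnbrs E U v = {u \<in> U. {u, v} \<notin> E}"

text \<open>For independent \<open>J\<close> these are the complete vertices of \<open>J\<close>.
  Prescribing the whole non-neighbourhood makes the classes of different \<open>J\<close> visibly
  disjoint.\<close>

definition twins :: "'a set set \<Rightarrow> 'a set \<Rightarrow> 'a set \<Rightarrow> 'a set" where
  "twins E U J = {v \<in> U. nonnbrs E U v = J}"

definition indeps :: "'a set set \<Rightarrow> 'a set \<Rightarrow> 'a set set" where
  "indeps E U = {J. J \<subseteq> U \<and> indep J E}"

definition surcharge :: "real \<Rightarrow> 'a set set \<Rightarrow> 'a set \<Rightarrow> 'a set \<Rightarrow> real" where
  "surcharge \<sigma> E U J = max 0 (real (card (twins E U J)) - (1 - \<sigma>) * real (card J))"

definition potential :: "real \<Rightarrow> 'a set set \<Rightarrow> 'a set \<Rightarrow> real" where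
  "potential \<sigma> E U = (\<Sum>v\<in>U. real (card (nonnbrs E U v)) - \<sigma>) + (\<Sum>J\<in>indeps E U. surcharge \<sigma> E U J)"

text \<open>For disjoint \<open>D\<close> and \<open>W\<close> this is the number of non-adjacent
  pairs between them.\<close>

definition crossing :: "'a set set \<Rightarrow> 'a set \<Rightarrow> 'a set \<Rightarrow> nat" where
  "crossing E D W = (\<Sum>z\<in>W. card (nonnbrs E D z))"

definition loopless :: "'a set set \<Rightarrow> bool" where
  "loopless E \<longleftrightarrow> (\<forall>v. {v} \<notin> E)"

lemma nonnbrs_subset: "nonnbrs E U v \<subseteq> U"
  by (auto simp: nonnbrs_def)

lemma finite_nonnbrs: "finite U \<Longrightarrow> finite (nonnbrs E U v)"
  using finite_subset[OF nonnbrs_subset] .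

lemma self_in_nonnbrs: "loopless E \<Longrightarrow> v \<in> U \<Longrightarrow> v \<in> nonnbrs E U v"
  by (auto simp: nonnbrs_def loopless_def)

lemma card_nonnbrs_pos: "loopless E \<Longrightarrow> finite U \<Longrightarrow> v \<in> U \<Longrightarrow> card (nonnbrs E U v) \<ge> 1"
  using self_in_nonnbrs[of E v U] finite_nonnbrs[of U E v] by (auto simp: Suc_le_eq card_gt_0_iff)

lemma twins_subset: "loopless E \<Longrightarrow> twins E U J \<subseteq> J"
  using self_in_nonnbrs by (auto simp: twins_def)

lemma finite_twins: "finite U \<Longrightarrow> finite (twins E U J)"
  by (simp add: twins_def)

lemma finite_indeps: "finite U \<Longrightarrow> finite (indeps E U)"
  by (simp add: indeps_def)

lemma indeps_mono: "W \<subseteq> U \<Longrightarrow> indeps E W \<subseteq> indeps E U"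
  by (auto simp: indeps_def)

lemma surcharge_nonneg: "surcharge \<sigma> E U J \<ge> 0"
  by (simp add: surcharge_def)

lemma potential_nonneg:
  assumes "finite U" "loopless E" "\<sigma> \<le> 1"
  shows "potential \<sigma> E U \<ge> 0"
proof -
  have "real (card (nonnbrs E U v)) - \<sigma> \<ge> 0" if "v \<in> U" for v
    using card_nonnbrs_pos[OF assms(2,1) that] assms(3) by linarith
  then show ?thesis
    unfolding potential_def by (intro add_nonneg_nonneg sum_nonneg) (auto simp: surcharge_nonneg)
qed

section \<open>Change of the potential under a deletion\<close>

lemma crossing_commute:
  assumes "finite D" "finite W"
  shows "crossing E D W = crossing E W D"
proof -
  have "(\<Sum>z\<in>W. \<Sum>u\<in>D. if {u, z} \<notin> E then 1 else (0::nat)) = (\<Sum>u\<in>D. \<Sum>z\<in>W. if {u, z} \<notin> E then 1 else 0)"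
    by (rule sum.swap)
  then show ?thesis
    using assms by (simp add: crossing_def nonnbrs_def sum.If_cases insert_commute Int_def)
qed

lemma card_nonnbrs_Diff:
  assumes "finite U" "D \<subseteq> U"
  shows "card (nonnbrs E U v) = card (nonnbrs E D v) + card (nonnbrs E (U - D) v)"
proof -
  have "nonnbrs E U v = nonnbrs E D v \<union> nonnbrs E (U - D) v"
    using assms by (auto simp: nonnbrs_def)
  moreover have "nonnbrs E D v \<inter> nonnbrs E (U - D) v = {}"
    by (auto simp: nonnbrs_def)
  ultimately show ?thesis
    using assms by (simp add: card_Un_disjoint finite_nonnbrs finite_subset)
qed

lemma sum_card_nonnbrs_Diff:
  assumes "finite U" "D \<subseteq> U"
  shows "(\<Sum>v\<in>U. real (card (nonnbrs E U v)) - \<sigma>) =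
    (\<Sum>v\<in>D. real (card (nonnbrs E U v)) - \<sigma>) + (\<Sum>v\<in>U - D. real (card (nonnbrs E (U - D) v)) - \<sigma>)
    + real (crossing E D (U - D))"
proof -
  have "(\<Sum>v\<in>U - D. real (card (nonnbrs E U v)) - \<sigma>) =
      (\<Sum>v\<in>U - D. (real (card (nonnbrs E (U - D) v)) - \<sigma>) + real (card (nonnbrs E D v)))"
    using card_nonnbrs_Diff[OF assms] by (intro sum.cong) simp_all
  then have "(\<Sum>v\<in>U - D. real (card (nonnbrs E U v)) - \<sigma>) =
      (\<Sum>v\<in>U - D. real (card (nonnbrs E (U - D) v)) - \<sigma>) + real (crossing E D (U - D))"
    by (simp add: sum.distrib crossing_def)
  then show ?thesis
    using sum.subset_diff[OF assms(2,1), of "\<lambda>v. real (card (nonnbrs E U v)) - \<sigma>"] by simp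
qed

text \<open>A vertex of \<open>U - D\<close> changes its class only by losing a non-neighbour in
  \<open>D\<close>. It lies in a single class, so it can be charged to one of its own crossing
  pairs.\<close>

lemma sum_new_twins_le_crossing:
  assumes "finite U" "D \<subseteq> U"
  shows "(\<Sum>J\<in>indeps E (U - D). card (twins E (U - D) J - twins E U J)) \<le> crossing E D (U - D)"
proof -
  let ?W = "U - D" and ?A = "{z \<in> U - D. nonnbrs E D z \<noteq> {}}"
  have fin: "finite D" "finite ?W"
    using assms finite_subset by auto
  have new: "twins E ?W J - twins E U J \<subseteq> ?A" for J
    using assms by (auto simp: twins_def nonnbrs_def)
  have "(\<Sum>J\<in>indeps E ?W. card (twins E ?W J - twins E U J)) =
      card (\<Union>J\<in>indeps E ?W. twins E ?W J - twins E U J)"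
    using fin by (intro card_UN_disjoint[symmetric]) (auto simp: finite_indeps finite_twins, auto simp: twins_def)
  also have "\<dots> \<le> card ?A"
    using new fin by (intro card_mono) auto
  also have "\<dots> = (\<Sum>z\<in>?A. 1)"
    by simp
  also have "\<dots> \<le> (\<Sum>z\<in>?A. card (nonnbrs E D z))"
    using fin by (intro sum_mono) (auto simp: Suc_le_eq card_gt_0_iff finite_nonnbrs)
  also have "\<dots> \<le> crossing E D ?W"
    unfolding crossing_def using fin by (intro sum_mono2) auto
  finally show ?thesis .
qed

text \<open>Each crossing pair lowers the count of a surviving vertex by one, and this pays for all
  growth of the surcharges. The surcharges of independent sets that meet \<open>D\<close> disappear
  and are a gain.\<close>

lemma potential_drop:
  assumes "finite U" "D \<subseteq> U"
  shows "potential \<sigma> E (U - D) + (\<Sum>v\<in>D. real (card (nonnbrs E U v)) - \<sigma>)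
    + (\<Sum>J\<in>indeps E U - indeps E (U - D). surcharge \<sigma> E U J) \<le> potential \<sigma> E U"
proof -
  let ?W = "U - D"
  have "surcharge \<sigma> E ?W J \<le> surcharge \<sigma> E U J + real (card (twins E ?W J - twins E U J))" for J
  proof -
    have "card (twins E ?W J) \<le> card (twins E U J \<union> (twins E ?W J - twins E U J))"
      using assms by (intro card_mono) (auto simp: finite_twins)
    also have "\<dots> \<le> card (twins E U J) + card (twins E ?W J - twins E U J)"
      by (rule card_Un_le)
    finally show ?thesis
      by (simp add: surcharge_def)
  qed
  then have "(\<Sum>J\<in>indeps E ?W. surcharge \<sigma> E ?W J) \<le>
      (\<Sum>J\<in>indeps E ?W. surcharge \<sigma> E U J + real (card (twins E ?W J - twins E U J)))"
    by (intro sum_mono)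
  also have "\<dots> \<le> (\<Sum>J\<in>indeps E ?W. surcharge \<sigma> E U J) + real (crossing E D ?W)"
    using sum_new_twins_le_crossing[OF assms, of E] by (simp add: sum.distrib flip: of_nat_sum)
  finally have "(\<Sum>J\<in>indeps E ?W. surcharge \<sigma> E ?W J) \<le>
      (\<Sum>J\<in>indeps E ?W. surcharge \<sigma> E U J) + real (crossing E D ?W)" .
  moreover have "(\<Sum>J\<in>indeps E U. surcharge \<sigma> E U J) =
      (\<Sum>J\<in>indeps E U - indeps E ?W. surcharge \<sigma> E U J) + (\<Sum>J\<in>indeps E ?W. surcharge \<sigma> E U J)"
    using assms by (intro sum.subset_diff) (auto simp: finite_indeps indeps_mono)
  ultimately show ?thesis
    using sum_card_nonnbrs_Diff[OF assms, of E \<sigma>] by (simp add: potential_def)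
qed

text \<open>If all twins are new, \<open>t\<close> of them in \<open>J\<close> give a surcharge of
  at most \<open>\<sigma> * t\<close>, because \<open>t\<close> is at most \<open>card J\<close>. So
  the new surcharges use up only a fraction \<open>\<sigma>\<close> of the crossing pairs.\<close>

lemma potential_drop_no_twins:
  assumes "finite U" "D \<subseteq> U" "loopless E" "0 \<le> \<sigma>" "\<sigma> \<le> 1"
    and no_twins: "\<And>J. J \<in> indeps E U \<Longrightarrow> twins E U J = {}"
  shows "potential \<sigma> E (U - D) + (\<Sum>v\<in>D. real (card (nonnbrs E U v)) - \<sigma>)
    + (1 - \<sigma>) * real (crossing E D (U - D)) \<le> potential \<sigma> E U"
proof -
  let ?W = "U - D"
  have "surcharge \<sigma> E ?W J \<le> \<sigma> * real (card (twins E ?W J - twins E U J))" if J: "J \<in> indeps E ?W" for J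
  proof -
    have JU: "J \<in> indeps E U"
      using J indeps_mono[of ?W U] by auto
    have "finite J"
      using J assms(1) by (auto simp: indeps_def intro: finite_subset)
    then have "card (twins E ?W J) \<le> card J"
      by (intro card_mono twins_subset assms)
    then have "(1 - \<sigma>) * real (card (twins E ?W J)) \<le> (1 - \<sigma>) * real (card J)"
      using assms(5) by (intro mult_left_mono) auto
    then have "real (card (twins E ?W J)) - (1 - \<sigma>) * real (card J) \<le> \<sigma> * real (card (twins E ?W J))"
      by (simp add: algebra_simps)
    then show ?thesis
      using no_twins[OF JU] assms(4) by (simp add: surcharge_def)
  qed
  then have "(\<Sum>J\<in>indeps E ?W. surcharge \<sigma> E ?W J) \<le>
      (\<Sum>J\<in>indeps E ?W. \<sigma> * real (card (twins E ?W J - twins E U J)))"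
    by (intro sum_mono)
  also have "\<dots> = \<sigma> * real (\<Sum>J\<in>indeps E ?W. card (twins E ?W J - twins E U J))"
    by (simp add: sum_distrib_left)
  also have "\<dots> \<le> \<sigma> * real (crossing E D ?W)"
    using sum_new_twins_le_crossing[OF assms(1,2), of E] assms(4) by (intro mult_left_mono) (simp_all flip: of_nat_sum)
  finally have "(\<Sum>J\<in>indeps E ?W. surcharge \<sigma> E ?W J) \<le> \<sigma> * real (crossing E D ?W)" .
  moreover have "(\<Sum>J\<in>indeps E U. surcharge \<sigma> E U J) \<ge> 0"
    by (intro sum_nonneg) (simp add: surcharge_nonneg)
  ultimately show ?thesis
    using sum_card_nonnbrs_Diff[OF assms(1,2), of E \<sigma>] by (simp add: potential_def algebra_simps)
qed

text \<open>A Cauchy-Schwarz inequality without roots. It lets the bounds for the deleted and the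
  remaining part be added.\<close>

lemma square_add_le_mult_add:
  fixes a b p q x y :: real
  assumes "p\<^sup>2 \<le> a * x" "q\<^sup>2 \<le> b * y" "0 \<le> a" "0 \<le> b" "0 \<le> x" "0 \<le> y"
  shows "(p + q)\<^sup>2 \<le> (a + b) * (x + y)"
proof -
  have "(2 * p * q)\<^sup>2 = 4 * (p\<^sup>2 * q\<^sup>2)"
    by (simp add: power_mult_distrib)
  also have "\<dots> \<le> 4 * ((a * x) * (b * y))"
    using assms by (intro mult_left_mono mult_mono) auto
  also have "\<dots> = (a * y + b * x)\<^sup>2 - (a * y - b * x)\<^sup>2"
    by algebra
  also have "\<dots> \<le> (a * y + b * x)\<^sup>2"
    by simp
  finally have "2 * p * q \<le> a * y + b * x"
    by (rule power2_le_imp_le) (use assms in simp)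
  moreover have "(p + q)\<^sup>2 = p\<^sup>2 + q\<^sup>2 + 2 * p * q"
    by (rule power2_sum)
  moreover have "(a + b) * (x + y) = a * x + b * y + (a * y + b * x)"
    by (simp add: distrib_left distrib_right)
  ultimately show ?thesis
    using assms(1,2) by linarith
qed

section \<open>Deletable sets\<close>

text \<open>Let \<open>k = |J|\<close>, with \<open>t\<close> complete vertices. The other \<open>k - t\<close> vertices of \<open>J\<close> have a
  non-neighbour outside \<open>J\<close>, and this gain together with the surcharge makes up for the loss
  \<open>\<sigma> k\<close>: \<open>(k - t) + (t - (1 - \<sigma>) k) = \<sigma> k\<close>.\<close>
lemma removal_indep:
  assumes "finite U" "loopless E" "v \<in> U" and ind: "indep (nonnbrs E U v) E"
  defines "J \<equiv> nonnbrs E U v"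
  shows "potential \<sigma> E (U - J) + (real (card J))\<^sup>2 \<le> potential \<sigma> E U"
proof -
  let ?T = "twins E U J"
  have J: "J \<subseteq> U" "finite J" "v \<in> J"
    using assms by (auto simp: J_def nonnbrs_subset finite_nonnbrs self_in_nonnbrs)
  have T: "?T \<subseteq> J"
    by (rule twins_subset[OF assms(2)])
  have sub: "J \<subseteq> nonnbrs E U u" if "u \<in> J" for u
  proof
    fix w assume "w \<in> J"
    then show "w \<in> nonnbrs E U u"
      using that ind assms(2) J unfolding J_def[symmetric]
      by (cases "w = u") (auto simp: nonnbrs_def indep_def loopless_def)
  qed
  have ge: "real (card (nonnbrs E U u)) \<ge> real (card J) + (if u \<in> ?T then 0 else 1)" if u: "u \<in> J" for u
  proof (cases "u \<in> ?T")
    case True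
    then show ?thesis
      by (simp add: twins_def)
  next
    case False
    then have "J \<subset> nonnbrs E U u"
      using sub[OF u] u J(1) by (auto simp: twins_def)
    then show ?thesis
      using False psubset_card_mono[OF finite_nonnbrs[OF assms(1)], of J E u] by simp
  qed
  have "(\<Sum>u\<in>J. (if u \<in> ?T then 0 else 1::real)) = real (card (J - ?T))"
    using J by (simp add: sum.If_cases Diff_eq)
  also have "\<dots> = real (card J) - real (card ?T)"
    using T J by (simp add: card_Diff_subset finite_subset card_mono of_nat_diff)
  finally have "(\<Sum>u\<in>J. real (card (nonnbrs E U u)) - \<sigma>) \<ge>
      (real (card J))\<^sup>2 + (real (card J) - real (card ?T)) - \<sigma> * real (card J)"
    using sum_mono[of J "\<lambda>u. real (card J) + (if u \<in> ?T then 0 else 1)" "\<lambda>u. real (card (nonnbrs E U u))"] ge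
    by (simp add: sum_subtractf sum.distrib power2_eq_square)
  moreover have "surcharge \<sigma> E U J \<ge> real (card ?T) - (1 - \<sigma>) * real (card J)"
    by (simp add: surcharge_def)
  moreover have "J \<in> indeps E U - indeps E (U - J)"
    using J ind by (auto simp: indeps_def J_def)
  then have "(\<Sum>J\<in>indeps E U - indeps E (U - J). surcharge \<sigma> E U J) \<ge> surcharge \<sigma> E U J"
    using assms(1) by (intro member_le_sum) (auto simp: surcharge_nonneg finite_indeps)
  ultimately show ?thesis
    using potential_drop[OF assms(1) J(1), of \<sigma> E] by (simp add: algebra_simps)
qed

lemma potential_drop_min:
  assumes "finite U" "D \<subseteq> U" and min: "\<And>u. u \<in> U \<Longrightarrow> c \<le> card (nonnbrs E U u)"
  shows "potential \<sigma> E (U - D) + real (card D) * (real c - \<sigma>) \<le> potential \<sigma> E U"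
proof -
  have "(\<Sum>u\<in>D. real c - \<sigma>) \<le> (\<Sum>v\<in>D. real (card (nonnbrs E U v)) - \<sigma>)"
    using assms by (intro sum_mono) auto
  moreover have "(\<Sum>J\<in>indeps E U - indeps E (U - D). surcharge \<sigma> E U J) \<ge> 0"
    by (intro sum_nonneg) (simp add: surcharge_nonneg)
  ultimately show ?thesis
    using potential_drop[OF assms(1,2), of \<sigma> E] by simp
qed

text \<open>The non-neighbours of \<open>x\<close> and \<open>y\<close> outside \<open>D\<close>
  belong to crossing pairs, and since \<open>x\<close> and \<open>y\<close> are distinct no pair is
  used twice.\<close>

lemma card_nonnbrs_Un_le:
  assumes "finite U" "v \<in> U" "x \<in> nonnbrs E U v" "y \<in> nonnbrs E U v" "x \<noteq> y"
  defines "D \<equiv> nonnbrs E U v"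
  shows "card (nonnbrs E U x \<union> nonnbrs E U y) \<le> card D + crossing E D (U - D)"
proof -
  have D: "finite D" "D \<subseteq> U"
    using assms by (auto simp: finite_nonnbrs nonnbrs_subset)
  have "nonnbrs E U x \<union> nonnbrs E U y \<subseteq> D \<union> (nonnbrs E (U - D) x \<union> nonnbrs E (U - D) y)"
    by (auto simp: nonnbrs_def)
  then have "card (nonnbrs E U x \<union> nonnbrs E U y) \<le> card (D \<union> (nonnbrs E (U - D) x \<union> nonnbrs E (U - D) y))"
    using D assms(1) by (intro card_mono) (auto simp: finite_nonnbrs)
  also have "\<dots> \<le> card D + (card (nonnbrs E (U - D) x) + card (nonnbrs E (U - D) y))"
    by (meson add_left_mono card_Un_le order_trans)
  also have "card (nonnbrs E (U - D) x) + card (nonnbrs E (U - D) y) = (\<Sum>z\<in>{x, y}. card (nonnbrs E (U - D) z))"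
    using assms(5) by simp
  also have "\<dots> \<le> crossing E (U - D) D"
    unfolding crossing_def using D assms by (intro sum_mono2) auto
  also have "\<dots> = crossing E D (U - D)"
    using D assms(1) by (intro crossing_commute) auto
  finally show ?thesis
    by simp
qed

text \<open>Deleting all non-neighbours of \<open>K\<close> leaves only vertices adjacent to all of
  \<open>K\<close>, so any clique that remains can be extended by \<open>K\<close>.\<close>

lemma clique_removal:
  assumes "finite U" "U \<noteq> {}" "loopless E" "0 \<le> \<sigma>" "\<sigma> \<le> 1 / 2"
  obtains K where "K \<subseteq> U" "K \<noteq> {}" "clique K E"
    "potential \<sigma> E (U - (\<Union>x\<in>K. nonnbrs E U x)) + (real (card (\<Union>x\<in>K. nonnbrs E U x)))\<^sup>2 / real (card K)
       \<le> potential \<sigma> E U"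
proof (cases "\<exists>v\<in>U. indep (nonnbrs E U v) E")
  case True
  then obtain v where "v \<in> U" "indep (nonnbrs E U v) E" by auto
  then show thesis
    using removal_indep[OF assms(1,3), of v \<sigma>] by (intro that[of "{v}"]) (auto simp: clique_def)
next
  case False
  obtain v where v: "v \<in> U" and min: "\<And>u. u \<in> U \<Longrightarrow> card (nonnbrs E U v) \<le> card (nonnbrs E U u)"
    using arg_min_if_finite[OF assms(1,2), of "\<lambda>u. card (nonnbrs E U u)"] by (metis not_less)
  define D where "D = nonnbrs E U v"
  have D: "D \<subseteq> U" "finite D"
    using assms by (auto simp: D_def nonnbrs_subset finite_nonnbrs)
  \<comment> \<open>A twin would have the independent set \<open>J\<close> as its non-neighbourhood,
    which this case excludes.\<close>
  have no_twins: "twins E U J = {}" if "J \<in> indeps E U" for J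
    using False that by (auto simp: twins_def indeps_def)
  show thesis
  proof (cases "\<sigma> * real (card D) \<le> (1 - \<sigma>) * real (crossing E D (U - D))")
    case True
    \<comment> \<open>By minimality the terms of \<open>D\<close> give the square of
      \<open>card D\<close> up to a loss of \<open>\<sigma> * card D\<close>, which the crossing
      pairs cover by the case assumption.\<close>
    have "(\<Sum>u\<in>D. real (card D) - \<sigma>) \<le> (\<Sum>u\<in>D. real (card (nonnbrs E U u)) - \<sigma>)"
      using min D by (intro sum_mono) (auto simp: D_def)
    then have "potential \<sigma> E (U - D) + (real (card D))\<^sup>2 \<le> potential \<sigma> E U"
      using potential_drop_no_twins[OF assms(1) D(1) assms(3,4) _ no_twins] assms(5) True
      by (simp add: power2_eq_square algebra_simps)
    then show thesis
      using v by (intro that[of "{v}"]) (auto simp: clique_def D_def)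
  next
    case few: False
    obtain x y where xy: "x \<in> D" "y \<in> D" "x \<noteq> y" "{x, y} \<in> E"
      using False v by (auto simp: indep_def D_def)
    define B where "B = nonnbrs E U x \<union> nonnbrs E U y"
    have B: "B \<subseteq> U"
      by (simp add: B_def nonnbrs_subset)
    have "crossing E D (U - D) < card D"
    proof (rule ccontr)
      assume "\<not> ?thesis"
      \<comment> \<open>Here \<open>\<sigma> \<le> 1 / 2\<close> enters as
        \<open>\<sigma> \<le> 1 - \<sigma>\<close>.\<close>
      then have "\<sigma> * real (card D) \<le> (1 - \<sigma>) * real (crossing E D (U - D))"
        using assms(4,5) by (intro mult_mono) auto
      then show False
        using few by simp
    qed
    then have "card B < 2 * card D"
      using card_nonnbrs_Un_le[OF assms(1) v, of x E y] xy by (simp add: B_def D_def)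
    \<comment> \<open>Integrality provides the 1 that pays for \<open>2 * \<sigma>\<close>.\<close>
    then have "real (card B) + 1 \<le> 2 * real (card D)"
      by linarith
    then have "real (card B) \<le> 2 * (real (card D) - \<sigma>)"
      using assms(5) by (simp add: algebra_simps)
    then have "(real (card B))\<^sup>2 / 2 \<le> real (card B) * (real (card D) - \<sigma>)"
      using mult_left_mono[of "real (card B)" "2 * (real (card D) - \<sigma>)" "real (card B)"]
      by (simp add: power2_eq_square algebra_simps)
    then have "potential \<sigma> E (U - B) + (real (card B))\<^sup>2 / 2 \<le> potential \<sigma> E U"
      using potential_drop_min[OF assms(1) B min, of \<sigma>] by (simp add: D_def)
    then show thesis
      using xy D(1) by (intro that[of "{x, y}"]) (auto simp: clique_def B_def insert_commute)
  qed
qed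

section \<open>Induction on the vertex set\<close>

lemma exists_clique_potential:
  assumes "finite U" "loopless E" "0 \<le> \<sigma>" "\<sigma> \<le> 1 / 2"
  shows "\<exists>S\<subseteq>U. clique S E \<and> (real (card U))\<^sup>2 \<le> real (card S) * potential \<sigma> E U"
  using assms(1)
proof (induction U rule: finite_psubset_induct)
  case (psubset U)
  show ?case
  proof (cases "U = {}")
    case True
    then show ?thesis
      by (auto simp: clique_def)
  next
    case False
    obtain K where K: "K \<subseteq> U" "K \<noteq> {}" "clique K E"
      "potential \<sigma> E (U - (\<Union>x\<in>K. nonnbrs E U x)) + (real (card (\<Union>x\<in>K. nonnbrs E U x)))\<^sup>2 / real (card K)
         \<le> potential \<sigma> E U"
      using clique_removal[OF psubset.hyps(1) False assms(2-4)] by metis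
    define B where "B = (\<Union>x\<in>K. nonnbrs E U x)"
    have B: "B \<subseteq> U"
      by (auto simp: B_def nonnbrs_def)
    have KB: "K \<subseteq> B"
      using K(1) self_in_nonnbrs[OF assms(2)] by (auto simp: B_def)
    have "U - B \<subset> U"
      using K KB by auto
    from psubset.IH[OF this] obtain S where S: "S \<subseteq> U - B" "clique S E"
      "(real (card (U - B)))\<^sup>2 \<le> real (card S) * potential \<sigma> E (U - B)"
      by auto
    have fin: "finite K" "finite S"
      using K S psubset.hyps(1) by (auto intro: finite_subset)
    have "{x, s} \<in> E \<and> {s, x} \<in> E" if "x \<in> K" "s \<in> S" for x s
    proof (rule ccontr)
      assume "\<not> ({x, s} \<in> E \<and> {s, x} \<in> E)"
      then have "s \<in> nonnbrs E U x"
        using that S by (auto simp: nonnbrs_def insert_commute)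
      then show False
        using that S by (auto simp: B_def)
    qed
    then have "clique (S \<union> K) E"
      using K(3) S(2) by (auto simp: clique_def)
    moreover have "S \<union> K \<subseteq> U"
      using K S by auto
    moreover have "(real (card U))\<^sup>2 \<le> real (card (S \<union> K)) * potential \<sigma> E U"
    proof -
      have kpos: "real (card K) > 0"
        using K fin by (simp add: card_gt_0_iff)
      \<comment> \<open>For \<open>B\<close> the hypothesis of the inequality is an equality: the
        square of \<open>card B\<close> is \<open>card K\<close> times its quotient by
        \<open>card K\<close>.\<close>
      have "(real (card (U - B)) + real (card B))\<^sup>2 \<le>
          (real (card S) + real (card K)) * (potential \<sigma> E (U - B) + (real (card B))\<^sup>2 / real (card K))"
        using S(3) kpos potential_nonneg[of "U - B" E \<sigma>] psubset.hyps(1) assms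
        by (intro square_add_le_mult_add) auto
      also have "\<dots> \<le> (real (card S) + real (card K)) * potential \<sigma> E U"
        using K(4) by (intro mult_left_mono) (auto simp: B_def)
      also have "real (card S) + real (card K) = real (card (S \<union> K))"
        using fin S KB by (subst card_Un_disjoint) auto
      also have "real (card (U - B)) + real (card B) = real (card U)"
        using B psubset.hyps(1) by (simp add: card_Diff_subset finite_subset card_mono of_nat_diff)
      finally show ?thesis .
    qed
    ultimately show ?thesis
      by blast
  qed
qed

section \<open>Counting edges and translating complete vertices\<close>

lemma sum_card_nonnbrs:
  assumes "finite V" "E \<subseteq> nsets V 2"
  shows "(\<Sum>v\<in>V. card (nonnbrs E V v)) + 2 * card E = (card V)\<^sup>2"
proof -
  have finE: "finite E"
    using assms finite_imp_finite_nsets finite_subset by blast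
  \<comment> \<open>As \<open>v\<close> is among its own non-neighbours, these and the neighbours
    partition \<open>V\<close>; the neighbours correspond to the edges at \<open>v\<close>.\<close>
  have deg: "card (nonnbrs E V v) + card {e \<in> E. v \<in> e} = card V" if v: "v \<in> V" for v
  proof -
    have "bij_betw (\<lambda>u. {u, v}) {u \<in> V. {u, v} \<in> E} {e \<in> E. v \<in> e}"
    proof (rule bij_betwI')
      fix u w assume "u \<in> {u \<in> V. {u, v} \<in> E}" "w \<in> {u \<in> V. {u, v} \<in> E}"
      then show "({u, v} = {w, v}) = (u = w)"
        by (auto simp: doubleton_eq_iff)
    next
      fix e assume e: "e \<in> {e \<in> E. v \<in> e}"
      then obtain a b where "e = {a, b}" "a \<in> V" "b \<in> V"
        using assms(2) by (auto simp: nsets_def card_2_iff)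
      then show "\<exists>u\<in>{u \<in> V. {u, v} \<in> E}. e = {u, v}"
        using e by (auto simp: insert_commute)
    qed auto
    then have "card {e \<in> E. v \<in> e} = card {u \<in> V. {u, v} \<in> E}"
      using bij_betw_same_card by force
    also have "card (nonnbrs E V v) + \<dots> = card (nonnbrs E V v \<union> {u \<in> V. {u, v} \<in> E})"
      using assms(1) by (intro card_Un_disjoint[symmetric]) (auto simp: nonnbrs_def)
    also have "nonnbrs E V v \<union> {u \<in> V. {u, v} \<in> E} = V"
      by (auto simp: nonnbrs_def)
    finally show ?thesis .
  qed
  have "card {v \<in> V. v \<in> e} = 2" if "e \<in> E" for e
  proof -
    have "{v \<in> V. v \<in> e} = e" "card e = 2"
      using that assms(2) by (auto simp: nsets_def)
    then show ?thesis by simp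
  qed
  then have "(\<Sum>v\<in>V. card {e \<in> E. v \<in> e}) = 2 * card E"
    using assms(1) finE by (intro sum_multicount) auto
  moreover have "(\<Sum>v\<in>V. card (nonnbrs E V v) + card {e \<in> E. v \<in> e}) = (\<Sum>v\<in>V. card V)"
    using deg by (intro sum.cong) auto
  ultimately show ?thesis
    by (simp add: sum.distrib power2_eq_square)
qed

text \<open>Independence puts \<open>I\<close> inside the non-neighbourhood of each of its vertices;
  completeness to the rest is the reverse inclusion.\<close>

lemma twins_eq_complete_to_rest:
  assumes "I \<subseteq> V" "indep I E" "loopless E"
  shows "twins E V I = {v \<in> I. complete_to_rest V E I v}"
proof (intro set_eqI iffI)
  fix v assume "v \<in> twins E V I"
  then show "v \<in> {v \<in> I. complete_to_rest V E I v}"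
    using twins_subset[OF assms(3), of V I]
    by (auto simp: twins_def nonnbrs_def complete_to_rest_def insert_commute)
next
  fix v assume v: "v \<in> {v \<in> I. complete_to_rest V E I v}"
  have "{u, v} \<notin> E" if "u \<in> I" for u
    using that v assms by (cases "u = v") (auto simp: indep_def loopless_def)
  then show "v \<in> twins E V I"
    using v assms(1) by (auto simp: twins_def nonnbrs_def complete_to_rest_def insert_commute)
qed

theorem theorem1p1:
  fixes V :: "'a set" and E :: "'a set set" and \<sigma> :: real and r :: nat
  assumes "\<sigma> \<le> 1 / 2"
    and "r \<ge> 1"
    and "finite_simple_graph V E"
    and "clique_free (r + 1) V E"
    and "real (card E) > (1 - 1 / real r) * (real (card V))\<^sup>2 / 2 - \<sigma> * real (card V) / 2"
  shows "\<exists>I\<subseteq>V. I \<noteq> {} \<and> indep I E \<and>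
           real (card {v \<in> I. complete_to_rest V E I v}) > (1 - \<sigma>) * (real (card I) - \<sigma>)"
proof (rule ccontr)
  assume contra: "\<not> ?thesis"
  have V: "finite V" "E \<subseteq> nsets V 2"
    using assms(3) by (auto simp: finite_simple_graph_def)
  then have loopless: "loopless E"
    by (auto simp: loopless_def nsets_def)
  \<comment> \<open>\<open>\<sigma>\<close> may be negative, while the potential argument needs a
    nonnegative parameter. Passing to \<open>\<tau>\<close> only strengthens the upper bound on the
    number of edges derived below.\<close>
  define \<tau> where "\<tau> = max 0 \<sigma>"
  have \<tau>: "0 \<le> \<tau>" "\<tau> \<le> 1 / 2" "\<sigma> \<le> \<tau>"
    using assms(1) by (auto simp: \<tau>_def)
  have "surcharge \<tau> E V J = 0" if J: "J \<in> indeps E V" for J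
  proof -
    have J': "J \<subseteq> V" "indep J E" "finite J"
      using J V by (auto simp: indeps_def intro: finite_subset)
    have le: "card (twins E V J) \<le> card J"
      by (intro card_mono J' twins_subset loopless)
    have "real (card (twins E V J)) \<le> (1 - \<tau>) * real (card J)"
    \<comment> \<open>The negated claim concerns nonempty sets only. If
      \<open>\<sigma> \<le> 0\<close>, then \<open>\<tau>\<close> is 0 and the bound just says that
      the twins lie in \<open>J\<close>.\<close>
    proof (cases "J = {} \<or> \<sigma> \<le> 0")
      case True
      then show ?thesis
        using le by (auto simp: \<tau>_def)
    next
      case False
      then have "real (card (twins E V J)) \<le> (1 - \<sigma>) * (real (card J) - \<sigma>)"
        using contra J' twins_eq_complete_to_rest[OF J'(1,2) loopless] by (auto simp: not_less)
      also have "\<dots> \<le> (1 - \<sigma>) * real (card J)"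
        using False assms(1) by (intro mult_left_mono) auto
      finally show ?thesis
        using False by (simp add: \<tau>_def)
    qed
    then show ?thesis
      by (simp add: surcharge_def)
  qed
  then have "potential \<tau> E V = real (\<Sum>v\<in>V. card (nonnbrs E V v)) - \<tau> * real (card V)"
    by (simp add: potential_def sum_subtractf)
  also have "real (\<Sum>v\<in>V. card (nonnbrs E V v)) = (real (card V))\<^sup>2 - 2 * real (card E)"
    using arg_cong[OF sum_card_nonnbrs[OF V], of real] by simp
  finally have pot: "potential \<tau> E V = (real (card V))\<^sup>2 - 2 * real (card E) - \<tau> * real (card V)" .
  obtain S where S: "S \<subseteq> V" "clique S E" "(real (card V))\<^sup>2 \<le> real (card S) * potential \<tau> E V"
    using exists_clique_potential[OF V(1) loopless \<tau>(1,2)] by auto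
  have "card S \<le> r"
  proof (rule ccontr)
    assume "\<not> card S \<le> r"
    then obtain K where "K \<subseteq> S" "card K = r + 1"
      using obtain_subset_with_card_n[of "r + 1" S] by auto
    moreover from this have "K \<subseteq> V" "clique K E"
      using S(1,2) unfolding clique_def by blast+
    ultimately show False
      using assms(4) unfolding clique_free_def by blast
  qed
  then have "(real (card V))\<^sup>2 \<le> real r * potential \<tau> E V"
    using S(3) potential_nonneg[OF V(1) loopless, of \<tau>] \<tau>(2)
      mult_right_mono[of "real (card S)" "real r" "potential \<tau> E V"] by simp
  \<comment> \<open>With \<open>pot\<close> this bounds twice the number of edges by
    \<open>(1 - 1 / r) * n^2 - \<tau> * n\<close>, where \<open>n\<close> is \<open>card V\<close>,
    against the hypothesis.\<close>
  then have "(real (card V))\<^sup>2 / real r \<le> potential \<tau> E V"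
    using assms(2) by (simp add: divide_le_eq mult.commute)
  moreover have "\<sigma> * real (card V) \<le> \<tau> * real (card V)"
    using \<tau>(3) by (intro mult_right_mono) auto
  ultimately show False
    using assms(5) pot by (simp add: algebra_simps)
qed

end
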